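(* Let $\Omega$ be a finite set with $m=|\Omega|\ge 2$, and let $P=(p(x,y))_{x,y\in\Omega}$ be a reversible Markov kernel on $\Omega$ with $p_*:=\min_{x,y\in\Omega}p(x,y)>0$. Then, for every integer $n\ge 2$, $$\operatorname{Gap}(\widetilde P_n)\;\ge\;\frac{p_*^4\,\bigl(1-\sqrt{\delta(P)}\bigr)^2}{4}\cdot\frac1n ,$$ where $\widetilde P_n$ is the resampled sliding-window count kernel of window length $n$ associated with $P$ and $\delta(P)$ is the Dobrushin coefficient of $P$.
   Context: Let $\pi$ be the (unique) stationary distribution of $P$; reversibility means $\pi(x)p(x,y)=\pi(y)p(y,x)$ for all $x,y$. The Dobrushin coefficient is $\delta(P)=\max_{x,y\in\Omega}\frac12\sum_{z\in\Omega}|p(x,z)-p(y,z)|$. Path law: for $u=(u_1,\dots,u_n)\in\Omega^n$, $\mu_n(u)=\pi(u_1)\prod_{i=1}^{n-1}p(u_i,u_{i+1})$. Counts: $N(u)=(N_x(u))_{x\in\Omega}$ with $N_x(u)=\#\{1\le i\le n:u_i=x\}$; $\Omega_n^{\#}=\{\eta\in\mathbb N^{\Omega}:\sum_x\eta_x=n\}$ (with $0\in\mathbb N$). The count law is $\widetilde\mu_n(\eta)=\sum_{u:N(u)=\eta}\mu_n(u)$; since $p_*>0$, it is strictly positive on $\Omega_n^{\#}$. Let $e_x$ denote the unit vector at coordinate $x$ in $\mathbb N^\Omega$. Count kernel on $\Omega_n^{\#}$: $$\widetilde P_n(\eta,\xi)=\frac1{\widetilde\mu_n(\eta)}\sum_{u\in\Omega^n:\,N(u)=\eta}\mu_n(u)\sum_{z\in\Omega}p(u_n,z)\,\mathbf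 1_{\{\eta-e_{u_1}+e_z=\xi\}} .$$ It is reversible with respect to $\widetilde\mu_n$. Spectral gap: for a Markov kernel $K$ on a finite set $S$ reversible with respect to a probability measure $\rho$, $\mathcal E_K(f,f)=\frac12\sum_{x,y\in S}\rho(x)K(x,y)(f(y)-f(x))^2$, $\operatorname{Var}_\rho(f)$ is the variance of $f$ under $\rho$, and $\operatorname{Gap}(K)=\inf\{\mathcal E_K(f,f)/\operatorname{Var}_\rho(f): f:S\to\mathbb R,\ \operatorname{Var}_\rho(f)>0\}$. *)

theory Defs
  imports Complex_Main "HOL-Library.Cardinality"
begin

text \<open>
  The state space is a finite type \<open>'a\<close>; kernels and distributions on it are real-valued
  functions. The count space is a proper subset of \<open>'a \<Rightarrow> nat\<close>, so the general notions
  (reversibility, Dirichlet form, variance, spectral gap) take an explicit carrier \<open>S\<close>.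
\<close>

definition distribution_on :: "'s set \<Rightarrow> ('s \<Rightarrow> real) \<Rightarrow> bool" where
  "distribution_on S \<rho> \<longleftrightarrow> (\<forall>x\<in>S. 0 \<le> \<rho> x) \<and> (\<Sum>x\<in>S. \<rho> x) = 1"

definition markov_kernel_on :: "'s set \<Rightarrow> ('s \<Rightarrow> 's \<Rightarrow> real) \<Rightarrow> bool" where
  "markov_kernel_on S K \<longleftrightarrow> (\<forall>x\<in>S. distribution_on S (K x))"

definition stationary_on :: "'s set \<Rightarrow> ('s \<Rightarrow> 's \<Rightarrow> real) \<Rightarrow> ('s \<Rightarrow> real) \<Rightarrow> bool" where
  "stationary_on S K \<rho> \<longleftrightarrow>
     distribution_on S \<rho> \<and> (\<forall>y\<in>S. (\<Sum>x\<in>S. \<rho> x * K x y) = \<rho> y)"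

definition reversible_on :: "'s set \<Rightarrow> ('s \<Rightarrow> 's \<Rightarrow> real) \<Rightarrow> ('s \<Rightarrow> real) \<Rightarrow> bool" where
  "reversible_on S K \<rho> \<longleftrightarrow> (\<forall>x\<in>S. \<forall>y\<in>S. \<rho> x * K x y = \<rho> y * K y x)"

definition dirichlet_form ::
    "'s set \<Rightarrow> ('s \<Rightarrow> 's \<Rightarrow> real) \<Rightarrow> ('s \<Rightarrow> real) \<Rightarrow> ('s \<Rightarrow> real) \<Rightarrow> real" where
  "dirichlet_form S K \<rho> f = (1/2) * (\<Sum>x\<in>S. \<Sum>y\<in>S. \<rho> x * K x y * (f y - f x)\<^sup>2)"

definition var_on :: "'s set \<Rightarrow> ('s \<Rightarrow> real) \<Rightarrow> ('s \<Rightarrow> real) \<Rightarrow> real" where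
  "var_on S \<rho> f = (\<Sum>x\<in>S. \<rho> x * (f x - (\<Sum>y\<in>S. \<rho> y * f y))\<^sup>2)"

text \<open>
  The infimum is that of the reals. It carries information only if some \<open>f\<close> has positive
  variance, i.e. if \<open>\<rho>\<close> charges at least two points of \<open>S\<close>.
\<close>

definition spectral_gap :: "'s set \<Rightarrow> ('s \<Rightarrow> 's \<Rightarrow> real) \<Rightarrow> ('s \<Rightarrow> real) \<Rightarrow> real" where
  "spectral_gap S K \<rho> = Inf {dirichlet_form S K \<rho> f / var_on S \<rho> f | f. var_on S \<rho> f > 0}"

definition min_entry :: "('a::finite \<Rightarrow> 'a \<Rightarrow> real) \<Rightarrow> real" where
  "min_entry p = Min {p x y | x y. True}"

definition dobrushin :: "('a::finite \<Rightarrow> 'a \<Rightarrow> real) \<Rightarrow> real" where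
  "dobrushin p = Max {(1/2) * (\<Sum>z\<in>UNIV. \<bar>p x z - p y z\<bar>) | x y. True}"

text \<open>
  A path \<open>u\<^sub>1, \<dots>, u\<^sub>n\<close> is a list of length \<open>n \<ge> 1\<close>; list indices start at 0. Its count
  vector \<open>N(u)\<close> is the library function \<^term>\<open>count_list u\<close> of type \<open>'a \<Rightarrow> nat\<close>.
\<close>

definition path_law :: "('a \<Rightarrow> 'a \<Rightarrow> real) \<Rightarrow> ('a \<Rightarrow> real) \<Rightarrow> 'a list \<Rightarrow> real" where
  "path_law p \<pi> u = \<pi> (u ! 0) * (\<Prod>i<length u - 1. p (u ! i) (u ! Suc i))"

definition count_space :: "nat \<Rightarrow> ('a::finite \<Rightarrow> nat) set" where
  "count_space n = {\<eta>. (\<Sum>x\<in>UNIV. \<eta> x) = n}"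

definition count_fibre :: "nat \<Rightarrow> ('a \<Rightarrow> nat) \<Rightarrow> 'a list set" where
  "count_fibre n \<eta> = {u. length u = n \<and> count_list u = \<eta>}"

definition count_law ::
    "('a::finite \<Rightarrow> 'a \<Rightarrow> real) \<Rightarrow> ('a \<Rightarrow> real) \<Rightarrow> nat \<Rightarrow> ('a \<Rightarrow> nat) \<Rightarrow> real" where
  "count_law p \<pi> n \<eta> = (\<Sum>u\<in>count_fibre n \<eta>. path_law p \<pi> u)"

definition unit_count :: "'a \<Rightarrow> 'a \<Rightarrow> nat" where
  "unit_count x y = (if y = x then 1 else 0)"

text \<open>
  The subtraction on \<^typ>\<open>nat\<close> below never truncates: every \<open>u\<close> in the fibre of \<open>\<eta>\<close> visits
  its own first state, so \<open>\<eta> (u ! 0) \<ge> 1\<close> (for \<open>n \<ge> 1\<close>).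
\<close>

definition count_kernel ::
    "('a::finite \<Rightarrow> 'a \<Rightarrow> real) \<Rightarrow> ('a \<Rightarrow> real) \<Rightarrow> nat \<Rightarrow> ('a \<Rightarrow> nat) \<Rightarrow> ('a \<Rightarrow> nat) \<Rightarrow> real" where
  "count_kernel p \<pi> n \<eta> \<xi> =
     1 / count_law p \<pi> n \<eta> *
     (\<Sum>u\<in>count_fibre n \<eta>. path_law p \<pi> u *
        (\<Sum>z\<in>UNIV. p (u ! (n - 1)) z *
           (if (\<lambda>x. \<eta> x - unit_count (u ! 0) x + unit_count z x) = \<xi> then 1 else 0)))"

end

theory Submission
  imports Defs "HOL-Library.FuncSet"
begin

text \<open>
  Under \<open>\<mu>\<^sub>n\<close>, the variance of \<open>F = f \<circ> N\<close> is the sum over the martingale increments of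
  \<open>E[F | u\<^sub>1, \<dots>, u\<^sub>k]\<close>. An increment compares two chains started at states \<open>x\<close>, \<open>y\<close> after a
  common past. Following a maximal coupling, the comparison is a sum over later times of single-site
  changes, and the one made \<open>j\<close> steps later happens with probability at most \<open>\<delta>(P)\<^sup>j\<close>;
  Cauchy--Schwarz turns this into a geometric series in \<open>\<surd>\<delta>(P)\<close>. The energy of a single-site change
  does not depend on the site up to a factor \<open>1/p\<^sub>*\<close>, because \<open>F\<close> ignores the order of the
  states, so the site may be moved to the front of the path. There the change is a move of the count
  kernel, at the cost of another factor \<open>1/p\<^sub>*\<^sup>2\<close>. In total
  \<open>Gap \<ge> p\<^sub>*\<^sup>3 (1 - \<surd>\<delta>(P))\<^sup>2 / n\<close>.
\<close>

section \<open>Sums over lists of fixed length, and quadratic inequalities\<close>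

lemma finite_length_eq: "finite {l :: 'a::finite list. length l = k}"
  using finite_lists_length_eq[of "UNIV :: 'a set" k] by simp

lemma sum_length_Suc:
  "(\<Sum>l | length l = Suc k. \<phi> l) = (\<Sum>l | length l = k. \<Sum>x\<in>UNIV. \<phi> (x # l))"
  for \<phi> :: "'a::finite list \<Rightarrow> real"
proof -
  have "(\<Sum>l | length l = k. \<Sum>x\<in>UNIV. \<phi> (x # l))
      = (\<Sum>(l, x)\<in>{l. length l = k} \<times> UNIV. \<phi> (x # l))"
    by (simp add: sum.cartesian_product)
  also have "\<dots> = (\<Sum>l | length l = Suc k. \<phi> l)"
    by (rule sum.reindex_bij_witness[where j = "\<lambda>(l, x). x # l" and i = "\<lambda>l. (tl l, hd l)"])
      (auto simp: length_Suc_conv)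
  finally show ?thesis by simp
qed

text \<open>Lagrange's identity, for weights of any total mass. It yields Cauchy--Schwarz below and
  later writes the variance of a martingale increment as a comparison of two independent
  draws.\<close>

lemma weighted_variance_eq_half_sum:
  fixes w g :: "'b \<Rightarrow> real"
  shows "(\<Sum>x\<in>A. w x) * (\<Sum>x\<in>A. w x * (g x)\<^sup>2) - (\<Sum>x\<in>A. w x * g x)\<^sup>2
    = 1 / 2 * (\<Sum>x\<in>A. \<Sum>y\<in>A. w x * w y * (g x - g y)\<^sup>2)"
proof -
  have "(\<Sum>x\<in>A. \<Sum>y\<in>A. w x * w y * (g x - g y)\<^sup>2)
      = (\<Sum>x\<in>A. \<Sum>y\<in>A. (w x * (g x)\<^sup>2) * w y + w x * (w y * (g y)\<^sup>2)
          - 2 * ((w x * g x) * (w y * g y)))"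
    by (intro sum.cong refl) (simp add: power2_eq_square algebra_simps)
  also have "\<dots> = 2 * ((\<Sum>x\<in>A. w x) * (\<Sum>x\<in>A. w x * (g x)\<^sup>2))
      - 2 * (\<Sum>x\<in>A. w x * g x)\<^sup>2"
    by (simp add: sum.distrib sum_subtractf power2_eq_square mult.commute
        flip: sum_distrib_left sum_distrib_right)
  finally show ?thesis by simp
qed

lemma weighted_mean_square_le:
  fixes w g :: "'b \<Rightarrow> real"
  assumes "\<And>x. x \<in> A \<Longrightarrow> 0 \<le> w x"
  shows "(\<Sum>x\<in>A. w x * g x)\<^sup>2 \<le> (\<Sum>x\<in>A. w x) * (\<Sum>x\<in>A. w x * (g x)\<^sup>2)"
proof -
  have "0 \<le> (\<Sum>x\<in>A. \<Sum>y\<in>A. w x * w y * (g x - g y)\<^sup>2)"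
    using assms by (intro sum_nonneg mult_nonneg_nonneg) auto
  then show ?thesis
    using weighted_variance_eq_half_sum[of w A g] by linarith
qed

text \<open>For \<open>0 < s\<close> this is convexity of the square applied to the mean of
  \<open>a / (1 - s)\<close> and \<open>b / s\<close> with weights \<open>1 - s\<close> and
  \<open>s\<close>. The factor \<open>s\<close> left before \<open>t\<close> becomes the ratio of
  the geometric series. Stating the hypothesis with \<open>s\<^sup>2 * t\<close> includes
  \<open>s = 0\<close>, where it forces \<open>b = 0\<close>.\<close>

lemma square_add_le_convex:
  fixes a b s t :: real
  assumes "0 \<le> s" "s < 1" "b\<^sup>2 \<le> s\<^sup>2 * t"
  shows "(a + b)\<^sup>2 \<le> a\<^sup>2 / (1 - s) + s * t"
proof (cases "s = 0")
  case True
  then show ?thesis using assms by simp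
next
  case False
  then have s: "0 < s" using assms by simp
  have "a\<^sup>2 / (1 - s) + b\<^sup>2 / s - (a + b)\<^sup>2 = (s * a - (1 - s) * b)\<^sup>2 / (s * (1 - s))"
    using s assms by (simp add: field_simps power2_eq_square)
  moreover have "\<dots> \<ge> 0" using s assms by simp
  moreover have "b\<^sup>2 / s \<le> s * t"
    using assms s by (simp add: divide_simps power2_eq_square mult_ac)
  ultimately show ?thesis by linarith
qed

section \<open>Transport between two distributions of equal mass\<close>

text \<open>
  The part of a maximal coupling of \<open>a\<close> and \<open>b\<close> that lives off the diagonal. For \<open>a = b\<close> the
  denominator vanishes, and so does the numerator.
\<close>

definition transport :: "('a::finite \<Rightarrow> real) \<Rightarrow> ('a \<Rightarrow> real) \<Rightarrow> 'a \<Rightarrow> 'a \<Rightarrow> real" where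
  "transport a b x y = max 0 (a x - b x) * max 0 (b y - a y) / ((1/2) * (\<Sum>z\<in>UNIV. \<bar>a z - b z\<bar>))"

lemma transport_nonneg: "0 \<le> transport a b x y"
  by (auto simp: transport_def intro!: divide_nonneg_nonneg mult_nonneg_nonneg sum_nonneg)

lemma sum_positive_part_diff:
  fixes a b :: "'a::finite \<Rightarrow> real"
  assumes "(\<Sum>x\<in>UNIV. a x) = (\<Sum>x\<in>UNIV. b x)"
  shows "(\<Sum>x\<in>UNIV. max 0 (a x - b x)) = (1/2) * (\<Sum>x\<in>UNIV. \<bar>a x - b x\<bar>)"
proof -
  have "(\<Sum>x\<in>UNIV. \<bar>a x - b x\<bar>) = (\<Sum>x\<in>UNIV. 2 * max 0 (a x - b x) - (a x - b x))"
    by (rule sum.cong) (auto simp: max_def)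
  also have "\<dots> = 2 * (\<Sum>x\<in>UNIV. max 0 (a x - b x))"
    using assms by (simp add: sum_subtractf flip: sum_distrib_left)
  finally show ?thesis by simp
qed

text \<open>The positive and negative parts of \<open>a - b\<close> have equal mass, namely the
  denominator, which therefore cancels when one variable is summed out.\<close>

lemma transport_marginals:
  fixes a b :: "'a::finite \<Rightarrow> real"
  assumes eq: "(\<Sum>x\<in>UNIV. a x) = (\<Sum>x\<in>UNIV. b x)"
  shows "(\<Sum>x\<in>UNIV. transport a b x y) = max 0 (b y - a y)"
    and "(\<Sum>y\<in>UNIV. transport a b x y) = max 0 (a x - b x)"
proof -
  define d where "d = (1/2) * (\<Sum>z\<in>UNIV. \<bar>a z - b z\<bar>)"
  have pos: "(\<Sum>x\<in>UNIV. max 0 (a x - b x)) = d"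
    unfolding d_def by (rule sum_positive_part_diff[OF eq])
  have neg: "(\<Sum>x\<in>UNIV. max 0 (b x - a x)) = d"
    unfolding d_def using sum_positive_part_diff[OF eq[symmetric]] by (simp add: abs_minus_commute)
  have zero: "a z = b z" if "d = 0" for z
    using that by (simp add: d_def sum_nonneg_eq_0_iff)
  have "(\<Sum>x\<in>UNIV. transport a b x y) = d * max 0 (b y - a y) / d"
    unfolding transport_def d_def[symmetric]
    by (simp only: sum_divide_distrib[symmetric] sum_distrib_right[symmetric] pos)
  then show "(\<Sum>x\<in>UNIV. transport a b x y) = max 0 (b y - a y)"
    using zero by (cases "d = 0") auto
  have "(\<Sum>y\<in>UNIV. transport a b x y) = max 0 (a x - b x) * d / d"
    unfolding transport_def d_def[symmetric]
    by (simp only: sum_divide_distrib[symmetric] sum_distrib_left[symmetric] neg)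
  then show "(\<Sum>y\<in>UNIV. transport a b x y) = max 0 (a x - b x)"
    using zero by (cases "d = 0") auto
qed

text \<open>A coupling represents the difference of the two expectations, and its diagonal
  contributes nothing, so the off-diagonal part suffices. In terms of marginals this is
  \<open>max 0 t - max 0 (- t) = t\<close>.\<close>

lemma sum_transport:
  fixes a b :: "'a::finite \<Rightarrow> real"
  assumes eq: "(\<Sum>x\<in>UNIV. a x) = (\<Sum>x\<in>UNIV. b x)"
  shows "(\<Sum>x\<in>UNIV. \<Sum>y\<in>UNIV. transport a b x y * (g x - g y)) = (\<Sum>x\<in>UNIV. (a x - b x) * g x)"
proof -
  have "(\<Sum>x\<in>UNIV. \<Sum>y\<in>UNIV. transport a b x y * (g x - g y))
      = (\<Sum>x\<in>UNIV. (\<Sum>y\<in>UNIV. transport a b x y) * g x)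
        - (\<Sum>x\<in>UNIV. \<Sum>y\<in>UNIV. transport a b x y * g y)"
    by (simp add: right_diff_distrib sum_subtractf sum_distrib_right)
  also have "(\<Sum>x\<in>UNIV. \<Sum>y\<in>UNIV. transport a b x y * g y)
      = (\<Sum>y\<in>UNIV. (\<Sum>x\<in>UNIV. transport a b x y) * g y)"
    by (subst sum.swap) (simp add: sum_distrib_right)
  finally show ?thesis
    unfolding transport_marginals[OF eq]
    by (simp flip: sum_subtractf left_diff_distrib) (intro sum.cong, auto simp: max_def)
qed

text \<open>Cauchy--Schwarz on the transport plan, whose total mass is the total variation distance.
  This is the source of one factor \<open>D\<close> per time step.\<close>

lemma square_sum_diff_le_transport:
  fixes a b :: "'a::finite \<Rightarrow> real"
  assumes eq: "(\<Sum>x\<in>UNIV. a x) = (\<Sum>x\<in>UNIV. b x)"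
    and D: "(1/2) * (\<Sum>x\<in>UNIV. \<bar>a x - b x\<bar>) \<le> D"
  shows "(\<Sum>x\<in>UNIV. (a x - b x) * g x)\<^sup>2
    \<le> D * (\<Sum>x\<in>UNIV. \<Sum>y\<in>UNIV. transport a b x y * (g x - g y)\<^sup>2)"
proof -
  have "(\<Sum>x\<in>UNIV. (a x - b x) * g x)\<^sup>2
      = (\<Sum>z\<in>UNIV \<times> UNIV. transport a b (fst z) (snd z) * (g (fst z) - g (snd z)))\<^sup>2"
    unfolding sum_transport[OF eq, symmetric] by (simp add: sum.cartesian_product case_prod_beta)
  also have "\<dots> \<le> (\<Sum>z\<in>UNIV \<times> UNIV. transport a b (fst z) (snd z))
      * (\<Sum>z\<in>UNIV \<times> UNIV. transport a b (fst z) (snd z) * (g (fst z) - g (snd z))\<^sup>2)"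
    by (rule weighted_mean_square_le) (auto intro: transport_nonneg)
  also have "\<dots> = (\<Sum>x\<in>UNIV. \<Sum>y\<in>UNIV. transport a b x y)
      * (\<Sum>x\<in>UNIV. \<Sum>y\<in>UNIV. transport a b x y * (g x - g y)\<^sup>2)"
    by (simp add: sum.cartesian_product case_prod_beta)
  also have "\<dots> \<le> D * (\<Sum>x\<in>UNIV. \<Sum>y\<in>UNIV. transport a b x y * (g x - g y)\<^sup>2)"
    using D sum_positive_part_diff[OF eq] unfolding transport_marginals[OF eq]
    by (intro mult_right_mono sum_nonneg mult_nonneg_nonneg transport_nonneg) auto
  finally show ?thesis .
qed

section \<open>The chain on histories and its conditional expectations\<close>

locale uniformly_positive_chain =
  fixes p :: "'a::finite \<Rightarrow> 'a \<Rightarrow> real" and \<pi> :: "'a \<Rightarrow> real" and c :: real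
  assumes c_pos: "0 < c"
    and p_ge: "c \<le> p x y" and p_sum: "(\<Sum>y\<in>UNIV. p x y) = 1"
    and pi_ge: "c \<le> \<pi> x" and pi_sum: "(\<Sum>x\<in>UNIV. \<pi> x) = 1"
begin

text \<open>A history \<open>l\<close> lists the visited states with the most recent one first.\<close>

definition step :: "'a list \<Rightarrow> 'a \<Rightarrow> real" where
  "step l w = (case l of [] \<Rightarrow> \<pi> w | x # _ \<Rightarrow> p x w)"

primrec law :: "'a list \<Rightarrow> real" where
  "law [] = 1"
| "law (w # l) = law l * step l w"

text \<open>The conditional expectation of \<open>F\<close> after \<open>j\<close> further steps,
  given the history \<open>l\<close>. Since \<open>step []\<close> is \<open>\<pi>\<close>, the
  initial draw counts as a step and \<open>cexp F j []\<close> is the unconditional mean.\<close>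

primrec cexp :: "('a list \<Rightarrow> real) \<Rightarrow> nat \<Rightarrow> 'a list \<Rightarrow> real" where
  "cexp F 0 l = F l"
| "cexp F (Suc j) l = (\<Sum>w\<in>UNIV. step l w * cexp F j (w # l))"

lemma p_pos: "0 < p x y"
  using p_ge[of x y] c_pos by linarith

lemma p_le_1: "p x y \<le> 1"
  using member_le_sum[of y UNIV "p x"] p_sum[of x] p_pos by (simp add: less_imp_le)

lemma step_Cons [simp]: "step (x # l) w = p x w"
  by (simp add: step_def)

lemma step_ge: "c \<le> step l w"
  by (simp add: step_def pi_ge p_ge split: list.split)

lemma step_pos: "0 < step l w"
  using step_ge[of l w] c_pos by linarith

lemma step_sum: "(\<Sum>w\<in>UNIV. step l w) = 1"
  by (cases l) (simp_all add: step_def pi_sum p_sum)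

lemma step_le_1: "step l w \<le> 1"
  using member_le_sum[of w UNIV "step l"] step_sum[of l] step_pos by (simp add: less_imp_le)

lemma c_le_1: "c \<le> 1"
  using p_ge[of undefined undefined] p_le_1[of undefined undefined] by linarith

lemma law_pos: "0 < law l"
  by (induction l) (simp_all add: step_pos)

lemma cexp_nonneg: "(\<And>l. 0 \<le> F l) \<Longrightarrow> 0 \<le> cexp F j l"
  by (induction j arbitrary: l) (auto intro!: sum_nonneg mult_nonneg_nonneg less_imp_le[OF step_pos])

lemma cexp_diff: "cexp (\<lambda>l. F l - G l) j l = cexp F j l - cexp G j l"
  by (induction j arbitrary: l) (simp_all add: right_diff_distrib sum_subtractf)

lemma cexp_square_le: "(cexp F j l)\<^sup>2 \<le> cexp (\<lambda>l. (F l)\<^sup>2) j l"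
proof (induction j arbitrary: l)
  case (Suc j)
  have "(cexp F (Suc j) l)\<^sup>2 \<le> (\<Sum>w\<in>UNIV. step l w * (cexp F j (w # l))\<^sup>2)"
    using weighted_mean_square_le[of UNIV "step l" "\<lambda>w. cexp F j (w # l)"]
    by (simp add: step_sum less_imp_le[OF step_pos])
  also have "\<dots> \<le> cexp (\<lambda>l. (F l)\<^sup>2) (Suc j) l"
    by (auto intro!: sum_mono mult_left_mono Suc.IH less_imp_le[OF step_pos])
  finally show ?case .
qed simp

text \<open>The tower property of conditional expectation.\<close>

lemma sum_law_cexp:
  "(\<Sum>l | length l = k. law l * cexp F j l) = (\<Sum>l | length l = k + j. law l * F l)"
proof (induction j arbitrary: k)
  case (Suc j)
  have "(\<Sum>l | length l = k. law l * cexp F (Suc j) l)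
      = (\<Sum>l | length l = Suc k. law l * cexp F j l)"
    by (simp add: sum_length_Suc sum_distrib_left mult.assoc)
  then show ?case by (simp add: Suc.IH)
qed simp

text \<open>By the Markov property only the newest state \<open>w\<close> drives the future, so an
  older state \<open>x\<close> enters through \<open>F\<close> alone, and \<open>F\<close> does not
  see its position. The list \<open>t\<close> absorbs the states added during the induction.\<close>

lemma cexp_drop_state:
  assumes F: "\<And>l l'. count_list l = count_list l' \<Longrightarrow> F l = F l'"
  shows "cexp F j (w # t @ x # l) = cexp (\<lambda>l. F (x # l)) j (w # t @ l)"
proof (induction j arbitrary: w t)
  case 0
  show ?case by (auto intro!: F)
next
  case (Suc j)
  show ?case using Suc.IH[of _ "w # t"] by simp
qed

section \<open>Single-site energy and couplings with a common past\<close>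

definition site_energy :: "('a list \<Rightarrow> real) \<Rightarrow> nat \<Rightarrow> real" where
  "site_energy F k = (\<Sum>l | length l = k. law l * (\<Sum>x\<in>UNIV. \<Sum>y\<in>UNIV. (F (x # l) - F (y # l))\<^sup>2))"

lemma site_energy_nonneg: "0 \<le> site_energy F k"
  unfolding site_energy_def
  by (intro sum_nonneg mult_nonneg_nonneg less_imp_le[OF law_pos]) auto

text \<open>
  The weights \<open>R\<close> cover every joint law of two states \<open>x\<close>, \<open>y\<close> and a common past \<open>l\<close> for which
  the history \<open>y # l\<close> has the law of the chain.
\<close>

definition sub_coupling :: "nat \<Rightarrow> ('a list \<Rightarrow> 'a \<Rightarrow> 'a \<Rightarrow> real) \<Rightarrow> bool" where
  "sub_coupling k R \<longleftrightarrow> (\<forall>l x y. 0 \<le> R l x y) \<and>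
     (\<forall>l y. length l = k \<longrightarrow> (\<Sum>x\<in>UNIV. R l x y) \<le> law (y # l))"

text \<open>This bound by the law of the past alone, uniform in \<open>x\<close> and
  \<open>y\<close>, is why \<open>site_energy\<close> can sum over the two states without
  weights.\<close>

lemma sub_coupling_le_law:
  assumes "sub_coupling k R" "length l = k"
  shows "R l x y \<le> law l"
proof -
  have "R l x y \<le> (\<Sum>x\<in>UNIV. R l x y)"
    using assms by (intro member_le_sum) (auto simp: sub_coupling_def)
  also have "\<dots> \<le> law l * step l y"
    using assms by (simp add: sub_coupling_def)
  also have "\<dots> \<le> law l"
    using step_le_1[of l y] law_pos[of l] by (simp add: mult_left_le)
  finally show ?thesis .
qed

lemma sum_sub_coupling_le:
  assumes R: "sub_coupling k R" and \<psi>: "\<And>l x y. 0 \<le> \<psi> l x y"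
  shows "(\<Sum>l | length l = k. \<Sum>x\<in>UNIV. \<Sum>y\<in>UNIV. R l x y * \<psi> l x y)
    \<le> (\<Sum>l | length l = k. law l * (\<Sum>x\<in>UNIV. \<Sum>y\<in>UNIV. \<psi> l x y))"
  unfolding sum_distrib_left
  using sub_coupling_le_law[OF R] by (intro sum_mono mult_right_mono \<psi>) auto

text \<open>The coupling one step later, restricted to differing next states. After the single-site
  change from \<open>x\<close> to \<open>y\<close> has been accounted for, \<open>y\<close> (the
  head of \<open>l\<close>) belongs to the common past, and \<open>x\<close> is summed out.\<close>

definition push :: "('a list \<Rightarrow> 'a \<Rightarrow> 'a \<Rightarrow> real) \<Rightarrow> 'a list \<Rightarrow> 'a \<Rightarrow> 'a \<Rightarrow> real" where
  "push R l w w' = (\<Sum>x\<in>UNIV. R (tl l) x (hd l) * transport (p x) (p (hd l)) w w')"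

text \<open>The second marginal of the transport plan from \<open>p x\<close> to \<open>p y\<close>
  is at most \<open>p y\<close>, so extending the second history by one step keeps it below the law
  of the chain.\<close>

lemma sub_coupling_push:
  assumes R: "sub_coupling k R"
  shows "sub_coupling (Suc k) (push R)"
  unfolding sub_coupling_def
proof (intro conjI allI impI)
  show "0 \<le> push R l x y" for l x y
    unfolding push_def using R
    by (intro sum_nonneg mult_nonneg_nonneg transport_nonneg) (auto simp: sub_coupling_def)
next
  fix l :: "'a list" and w' assume "length l = Suc k"
  then obtain y t where l: "l = y # t" and t: "length t = k" by (auto simp: length_Suc_conv)
  have "(\<Sum>w\<in>UNIV. push R l w w')
      = (\<Sum>x\<in>UNIV. R t x y * (\<Sum>w\<in>UNIV. transport (p x) (p y) w w'))"
    unfolding push_def l by (subst sum.swap) (simp add: sum_distrib_left)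
  also have "\<dots> = (\<Sum>x\<in>UNIV. R t x y * max 0 (p y w' - p x w'))"
    by (subst transport_marginals) (simp_all add: p_sum)
  also have "\<dots> \<le> (\<Sum>x\<in>UNIV. R t x y * p y w')"
    using R p_pos by (intro sum_mono mult_left_mono) (auto simp: sub_coupling_def less_imp_le)
  also have "\<dots> \<le> law (y # t) * p y w'"
    unfolding sum_distrib_right[symmetric]
    using R t p_pos[of y w'] by (intro mult_right_mono) (auto simp: sub_coupling_def less_imp_le)
  finally show "(\<Sum>w\<in>UNIV. push R l w w') \<le> law (w' # l)"
    by (simp add: l)
qed

text \<open>Averaging the transport term of a one-step comparison over \<open>R\<close> gives the
  same kind of energy for \<open>push R\<close>, which lets the induction over time proceed.\<close>

lemma sum_push:
  "(\<Sum>l | length l = Suc k. \<Sum>w\<in>UNIV. \<Sum>w'\<in>UNIV. push R l w w' * \<psi> l w w')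
    = (\<Sum>l | length l = k. \<Sum>x\<in>UNIV. \<Sum>y\<in>UNIV. R l x y *
        (\<Sum>w\<in>UNIV. \<Sum>w'\<in>UNIV. transport (p x) (p y) w w' * \<psi> (y # l) w w'))"
proof -
  have "(\<Sum>w\<in>UNIV. \<Sum>w'\<in>UNIV. push R (y # l) w w' * \<psi> (y # l) w w')
      = (\<Sum>x\<in>UNIV. R l x y *
        (\<Sum>w\<in>UNIV. \<Sum>w'\<in>UNIV. transport (p x) (p y) w w' * \<psi> (y # l) w w'))" for y l
    unfolding push_def list.sel sum_distrib_left sum_distrib_right
    by (subst (2) sum.swap, subst sum.swap, subst (2) sum.swap)
      (simp add: mult.assoc, intro sum.cong refl sum.swap)
  then show ?thesis
    by (subst sum_length_Suc) (simp, subst (2) sum.swap, simp)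
qed

section \<open>Propagating a discrepancy through time\<close>

text \<open>
  Changing the state before \<open>j + 1\<close> further steps splits into the change of that single state,
  the future being driven by \<open>p x\<close>, and the change of the law of the next state.
\<close>

lemma cexp_diff_square_le:
  assumes F: "\<And>l l'. count_list l = count_list l' \<Longrightarrow> F l = F l'"
    and D: "\<And>x y. (1/2) * (\<Sum>z\<in>UNIV. \<bar>p x z - p y z\<bar>) \<le> D" and D1: "D < 1"
  shows "(cexp F (Suc j) (x # l) - cexp F (Suc j) (y # l))\<^sup>2
    \<le> cexp (\<lambda>l. (F (x # l) - F (y # l))\<^sup>2) (Suc j) l / c / (1 - sqrt D)
      + sqrt D * (\<Sum>w\<in>UNIV. \<Sum>w'\<in>UNIV. transport (p x) (p y) w w' *
          (cexp F j (w # y # l) - cexp F j (w' # y # l))\<^sup>2)"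
proof -
  let ?G = "\<lambda>l. F (x # l) - F (y # l)"
  define A where "A = (\<Sum>w\<in>UNIV. p x w * cexp ?G j (w # l))"
  define B where "B = (\<Sum>w\<in>UNIV. (p x w - p y w) * cexp F j (w # y # l))"
  define T where "T = (\<Sum>w\<in>UNIV. \<Sum>w'\<in>UNIV. transport (p x) (p y) w w' *
          (cexp F j (w # y # l) - cexp F j (w' # y # l))\<^sup>2)"
  have D0: "0 \<le> D" using D[of x x] by simp
  \<comment> \<open>The empty list is written out to match \<open>cexp_drop_state\<close> with
    \<open>t = []\<close>.\<close>
  have "cexp F j (w # [] @ z # l) = cexp (\<lambda>l. F (z # l)) j (w # [] @ l)" for w z
    by (rule cexp_drop_state) (erule F)
  then have drop: "cexp F j (w # z # l) = cexp (\<lambda>l. F (z # l)) j (w # l)" for w z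
    by simp
  have diff: "cexp F (Suc j) (x # l) - cexp F (Suc j) (y # l) = A + B"
    by (simp add: A_def B_def cexp_diff drop left_diff_distrib right_diff_distrib sum_subtractf)
  have "(A + B)\<^sup>2 \<le> A\<^sup>2 / (1 - sqrt D) + sqrt D * T"
  proof (rule square_add_le_convex)
    show "B\<^sup>2 \<le> (sqrt D)\<^sup>2 * T"
      unfolding B_def T_def real_sqrt_pow2[OF D0]
      by (rule square_sum_diff_le_transport) (simp_all only: p_sum D)
  qed (use D0 D1 in auto)
  moreover have "A\<^sup>2 \<le> cexp (\<lambda>l. (?G l)\<^sup>2) (Suc j) l / c"
  proof -
    have "A\<^sup>2 \<le> (\<Sum>w\<in>UNIV. p x w * (cexp ?G j (w # l))\<^sup>2)"
      using weighted_mean_square_le[of UNIV "p x" "\<lambda>w. cexp ?G j (w # l)"]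
      by (simp add: A_def p_sum less_imp_le[OF p_pos])
    \<comment> \<open>With \<open>x\<close> removed, \<open>w\<close> follows the history
      \<open>l\<close> but is still drawn from \<open>p x\<close>. Redrawing it from
      \<open>step l\<close> costs \<open>1 / c\<close>, because
      \<open>p x w \<le> 1 \<le> step l w / c\<close>.\<close>
    also have "\<dots> \<le> (\<Sum>w\<in>UNIV. (step l w / c) * cexp (\<lambda>l. (?G l)\<^sup>2) j (w # l))"
    proof (intro sum_mono mult_mono cexp_square_le)
      show "p x w \<le> step l w / c" for w
        using step_ge[of l w] c_pos
        by (intro order.trans[OF p_le_1]) simp
      show "0 \<le> step l w / c" for w
        using step_pos[of l w] c_pos by simp
    qed auto
    finally show ?thesis by (simp add: sum_divide_distrib)
  qed
  then have "A\<^sup>2 / (1 - sqrt D) \<le> cexp (\<lambda>l. (?G l)\<^sup>2) (Suc j) l / c / (1 - sqrt D)"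
    using D1 by (intro divide_right_mono) simp_all
  ultimately show ?thesis unfolding diff T_def by linarith
qed

text \<open>Induction on the number of steps left, with \<open>R\<close> replaced by
  \<open>push R\<close>. The sum \<open>k + j\<close> is preserved, so the same site energy
  \<open>S\<close> occurs throughout. With \<open>s = sqrt D\<close>, the bound
  \<open>X = S / c / (1 - s)\<^sup>2\<close> is the fixed point of
  \<open>X = S / c / (1 - s) + s * X\<close>, which sums the geometric series.\<close>

lemma sub_coupling_energy_le:
  assumes F: "\<And>l l'. count_list l = count_list l' \<Longrightarrow> F l = F l'"
    and D: "\<And>x y. (1/2) * (\<Sum>z\<in>UNIV. \<bar>p x z - p y z\<bar>) \<le> D" and D1: "D < 1"
    and R: "sub_coupling k R"
  shows "(\<Sum>l | length l = k. \<Sum>x\<in>UNIV. \<Sum>y\<in>UNIV.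
      R l x y * (cexp F j (x # l) - cexp F j (y # l))\<^sup>2)
    \<le> site_energy F (k + j) / c / (1 - sqrt D)\<^sup>2"
  using R
proof (induction j arbitrary: k R)
  case 0
  have D0: "0 \<le> D" using D[of undefined undefined] by simp
  have "(\<Sum>l | length l = k. \<Sum>x\<in>UNIV. \<Sum>y\<in>UNIV.
      R l x y * (cexp F 0 (x # l) - cexp F 0 (y # l))\<^sup>2) \<le> site_energy F k"
    unfolding site_energy_def using sum_sub_coupling_le[OF 0] by simp
  also have "\<dots> \<le> site_energy F k / (c * (1 - sqrt D)\<^sup>2)"
  proof -
    have "c * (1 - sqrt D)\<^sup>2 \<le> 1 * 1"
      using c_le_1 c_pos D0 D1 by (intro mult_mono power_le_one) simp_all
    moreover have "0 < c * (1 - sqrt D)\<^sup>2"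
      using c_pos D1 by simp
    ultimately show ?thesis
      using site_energy_nonneg[of F k] by (simp add: pos_le_divide_eq mult_left_le)
  qed
  finally show ?case by simp
next
  case (Suc j)
  let ?s = "sqrt D"
  let ?E = "\<lambda>j l x y. (cexp F j (x # l) - cexp F j (y # l))\<^sup>2"
  define S where "S = site_energy F (Suc (k + j))"
  have D0: "0 \<le> D" using D[of undefined undefined] by simp
  let ?C = "\<lambda>l x y. cexp (\<lambda>l. (F (x # l) - F (y # l))\<^sup>2) (Suc j) l"
  have "(\<Sum>l | length l = k. \<Sum>x\<in>UNIV. \<Sum>y\<in>UNIV. R l x y * ?E (Suc j) l x y)
      \<le> (\<Sum>l | length l = k. \<Sum>x\<in>UNIV. \<Sum>y\<in>UNIV. R l x y * (?C l x y / c / (1 - ?s)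
          + ?s * (\<Sum>w\<in>UNIV. \<Sum>w'\<in>UNIV. transport (p x) (p y) w w' * ?E j (y # l) w w')))"
    using Suc.prems
    by (intro sum_mono mult_left_mono cexp_diff_square_le F D D1) (auto simp: sub_coupling_def)
  also have "\<dots> = (\<Sum>l | length l = k. \<Sum>x\<in>UNIV. \<Sum>y\<in>UNIV. R l x y * ?C l x y) / c / (1 - ?s)
      + ?s * (\<Sum>l | length l = k. \<Sum>x\<in>UNIV. \<Sum>y\<in>UNIV. R l x y *
          (\<Sum>w\<in>UNIV. \<Sum>w'\<in>UNIV. transport (p x) (p y) w w' * ?E j (y # l) w w'))"
    by (simp only: distrib_left sum.distrib sum_divide_distrib sum_distrib_left[symmetric]
        times_divide_eq_right mult.left_commute[of _ ?s])
  also have "\<dots> \<le> S / c / (1 - ?s) + ?s * (S / c / (1 - ?s)\<^sup>2)"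
  proof (intro add_mono mult_left_mono divide_right_mono)
    have "(\<Sum>l | length l = k. \<Sum>x\<in>UNIV. \<Sum>y\<in>UNIV. R l x y * ?C l x y)
        \<le> (\<Sum>l | length l = k. law l * (\<Sum>x\<in>UNIV. \<Sum>y\<in>UNIV. ?C l x y))"
      using Suc.prems by (intro sum_sub_coupling_le cexp_nonneg) auto
    \<comment> \<open>With \<open>x\<close> and \<open>y\<close> fixed outside, the tower property
      applies to the sum over histories.\<close>
    also have "\<dots> = (\<Sum>x\<in>UNIV. \<Sum>y\<in>UNIV. \<Sum>l | length l = k. law l * ?C l x y)"
      unfolding sum_distrib_left by (subst sum.swap, subst (2) sum.swap) simp
    also have "\<dots> = (\<Sum>x\<in>UNIV. \<Sum>y\<in>UNIV. \<Sum>l | length l = Suc (k + j).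
        law l * (F (x # l) - F (y # l))\<^sup>2)"
      by (simp only: sum_law_cexp add_Suc_right)
    also have "\<dots> = S"
      unfolding S_def site_energy_def sum_distrib_left by (subst (2) sum.swap, subst sum.swap) simp
    finally show "(\<Sum>l | length l = k. \<Sum>x\<in>UNIV. \<Sum>y\<in>UNIV. R l x y * ?C l x y) \<le> S" .
    show "(\<Sum>l | length l = k. \<Sum>x\<in>UNIV. \<Sum>y\<in>UNIV. R l x y *
          (\<Sum>w\<in>UNIV. \<Sum>w'\<in>UNIV. transport (p x) (p y) w w' * ?E j (y # l) w w'))
        \<le> S / c / (1 - ?s)\<^sup>2"
      using Suc.IH[OF sub_coupling_push[OF Suc.prems]] unfolding sum_push S_def by simp
  qed (use c_pos D0 D1 in auto)
  also have "\<dots> = S / c / (1 - ?s)\<^sup>2"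
    using D1 c_pos by (simp add: divide_simps power2_eq_square) (simp add: algebra_simps)
  finally show ?case by (simp add: S_def)
qed

section \<open>Martingale decomposition of the variance\<close>

lemma variance_le_site_energy:
  assumes F: "\<And>l l'. count_list l = count_list l' \<Longrightarrow> F l = F l'"
    and D: "\<And>x y. (1/2) * (\<Sum>z\<in>UNIV. \<bar>p x z - p y z\<bar>) \<le> D" and D1: "D < 1"
  shows "(\<Sum>l | length l = Suc n. law l * (F l)\<^sup>2) - (\<Sum>l | length l = Suc n. law l * F l)\<^sup>2
    \<le> real (Suc n) * (site_energy F n / c / (1 - sqrt D)\<^sup>2 / 2)"
proof -
  \<comment> \<open>\<open>V k\<close> is the second moment of the martingale at time
    \<open>k\<close>. It runs from the squared mean at \<open>k = 0\<close> to the second moment of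
    \<open>F\<close> at \<open>k = Suc n\<close>, and its increments are averaged conditional
    variances.\<close>
  define V where "V k = (\<Sum>l | length l = k. law l * (cexp F (Suc n - k) l)\<^sup>2)" for k
  have V_step: "V (Suc k) - V k \<le> site_energy F n / c / (1 - sqrt D)\<^sup>2 / 2" if k: "k \<le> n" for k
  proof -
    have j: "Suc n - k = Suc (n - k)" using k by simp
    \<comment> \<open>Two independent draws of the next state after \<open>l\<close>; the marginal
      condition of \<open>sub_coupling\<close> holds with equality.\<close>
    let ?R = "\<lambda>l x y. law l * step l x * step l y"
    have R: "sub_coupling k ?R"
      unfolding sub_coupling_def
      by (auto simp: less_imp_le[OF law_pos] less_imp_le[OF step_pos] step_sum
          simp flip: sum_distrib_left sum_distrib_right)
    have "V (Suc k) - V k = (\<Sum>l | length l = k. law l *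
        ((\<Sum>w\<in>UNIV. step l w * (cexp F (n - k) (w # l))\<^sup>2)
          - (\<Sum>w\<in>UNIV. step l w * cexp F (n - k) (w # l))\<^sup>2))"
      unfolding V_def j
      by (subst sum_length_Suc)
        (simp add: right_diff_distrib sum_subtractf sum_distrib_left mult.assoc)
    also have "\<dots> = (\<Sum>l | length l = k. \<Sum>x\<in>UNIV. \<Sum>y\<in>UNIV.
        ?R l x y * (cexp F (n - k) (x # l) - cexp F (n - k) (y # l))\<^sup>2) / 2"
      using weighted_variance_eq_half_sum[of "step l" UNIV "\<lambda>w. cexp F (n - k) (w # l)" for l]
      by (simp add: step_sum sum_distrib_left sum_divide_distrib mult_ac)
    also have "\<dots> \<le> site_energy F (k + (n - k)) / c / (1 - sqrt D)\<^sup>2 / 2"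
      by (intro divide_right_mono sub_coupling_energy_le F D D1 R) simp_all
    finally show ?thesis using k by simp
  qed
  have "V (Suc n) - V 0 = (\<Sum>k<Suc n. V (Suc k) - V k)"
    by (rule sum_lessThan_telescope[symmetric])
  also have "\<dots> \<le> (\<Sum>k<Suc n. site_energy F n / c / (1 - sqrt D)\<^sup>2 / 2)"
    by (intro sum_mono V_step) simp
  also have "\<dots> = real (Suc n) * (site_energy F n / c / (1 - sqrt D)\<^sup>2 / 2)"
    by simp
  finally have "V (Suc n) - V 0 \<le> \<dots>" .
  moreover have "V 0 = (\<Sum>l | length l = Suc n. law l * F l)\<^sup>2"
    using sum_law_cexp[where k = 0 and F = F and j = "Suc n"] unfolding V_def by simp
  ultimately show ?thesis unfolding V_def by simp
qed

section \<open>Histories as reversed paths\<close>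

lemma sum_law: "(\<Sum>l | length l = n. law l) = 1"
proof (induction n)
  case (Suc n)
  then show ?case by (simp add: sum_length_Suc step_sum flip: sum_distrib_left)
qed simp

text \<open>The head of the list is the first state for \<open>path_law\<close> but the newest one
  for \<open>law\<close>. Detailed balance carries \<open>\<pi>\<close> across one edge at a time
  and so reverses the path. The newest state of a history thereby becomes the state that the count
  kernel removes.\<close>

lemma path_law_eq_law:
  assumes rev: "\<And>x y. \<pi> x * p x y = \<pi> y * p y x" and "u \<noteq> []"
  shows "path_law p \<pi> u = law u"
  using \<open>u \<noteq> []\<close>
proof (induction u rule: list_nonempty_induct)
  case (single x)
  show ?case by (simp add: path_law_def step_def)
next
  case (cons x l)
  then obtain y t where l: "l = y # t" by (cases l) auto
  have "path_law p \<pi> (x # l) = \<pi> x * p x y * (\<Prod>i<length t. p (l ! i) (l ! Suc i))"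
    by (simp add: path_law_def l prod.lessThan_Suc_shift del: prod.lessThan_Suc)
  also have "\<dots> = path_law p \<pi> l * p y x"
    by (simp add: path_law_def l rev[of x y])
  finally show ?case using cons by (simp add: l)
qed

end

section \<open>Variance and Dirichlet form of counts as sums over paths\<close>

lemma count_fibre_subset: "count_fibre n \<eta> \<subseteq> {u. length u = n}"
  by (auto simp: count_fibre_def)

lemma finite_count_space: "finite (count_space n :: ('a::finite \<Rightarrow> nat) set)"
proof (rule finite_subset)
  show "count_space n \<subseteq> Pi\<^sub>E UNIV (\<lambda>_::'a. {..n})"
    by (auto simp: count_space_def PiE_iff intro: member_le_sum)
qed (auto intro: finite_PiE)

lemma count_list_in_count_space: "length u = n \<Longrightarrow> count_list u \<in> count_space n"
proof -
  have "(\<Sum>x\<in>UNIV. count_list u x) = length u"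
    using sum_count_set[of u UNIV] by simp
  then show "length u = n \<Longrightarrow> ?thesis" by (simp add: count_space_def)
qed

lemma sum_count_fibre:
  fixes \<phi> :: "'a::finite list \<Rightarrow> real"
  shows "(\<Sum>\<eta>\<in>count_space n. \<Sum>u\<in>count_fibre n \<eta>. \<phi> u) = (\<Sum>u | length u = n. \<phi> u)"
proof -
  have "(\<Sum>\<eta>\<in>count_space n. \<Sum>u | u \<in> {u. length u = n} \<and> count_list u = \<eta>. \<phi> u)
      = (\<Sum>u | length u = n. \<phi> u)"
    by (intro sum.group finite_length_eq finite_count_space)
      (auto intro: count_list_in_count_space)
  then show ?thesis by (simp add: count_fibre_def)
qed

lemma sum_count_law:
  "(\<Sum>\<eta>\<in>count_space n. count_law p \<pi> n \<eta> * h \<eta>)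
    = (\<Sum>u | length u = n. path_law p \<pi> u * h (count_list u))"
  unfolding sum_count_fibre[symmetric] count_law_def sum_distrib_right
  by (intro sum.cong refl) (auto simp: count_fibre_def)

lemma var_on_count_law:
  assumes "(\<Sum>u | length u = n. path_law p \<pi> u) = 1"
  shows "var_on (count_space n) (count_law p \<pi> n) f
    = (\<Sum>u | length u = n. path_law p \<pi> u * (f (count_list u))\<^sup>2)
      - (\<Sum>u | length u = n. path_law p \<pi> u * f (count_list u))\<^sup>2"
proof -
  define M where "M = (\<Sum>u | length u = n. path_law p \<pi> u * f (count_list u))"
  have "var_on (count_space n) (count_law p \<pi> n) f
      = (\<Sum>u | length u = n. path_law p \<pi> u * (f (count_list u) - M)\<^sup>2)"
    unfolding var_on_def sum_count_law M_def ..
  also have "\<dots> = (\<Sum>u | length u = n. path_law p \<pi> u * (f (count_list u))\<^sup>2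
      - 2 * M * (path_law p \<pi> u * f (count_list u)) + M\<^sup>2 * path_law p \<pi> u)"
    by (intro sum.cong refl) (simp add: power2_eq_square algebra_simps)
  also have "\<dots> = (\<Sum>u | length u = n. path_law p \<pi> u * (f (count_list u))\<^sup>2) - 2 * M * M + M\<^sup>2 * 1"
    unfolding sum.distrib sum_subtractf sum_distrib_left[symmetric] M_def[symmetric] assms ..
  finally show ?thesis by (simp add: M_def power2_eq_square)
qed

text \<open>The weight \<open>count_law\<close> cancels the normalisation of the kernel. What
  remains is an average over windows \<open>x # l\<close> of the replacement of \<open>x\<close> by
  \<open>z\<close>, with \<open>z\<close> drawn from the last state of the window.\<close>

lemma dirichlet_form_count_kernel:
  fixes p :: "'a::finite \<Rightarrow> 'a \<Rightarrow> real"
  assumes pos: "\<And>u. length u = Suc n \<Longrightarrow> 0 < path_law p \<pi> u"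
  shows "2 * dirichlet_form (count_space (Suc n)) (count_kernel p \<pi> (Suc n)) (count_law p \<pi> (Suc n)) f
    = (\<Sum>l | length l = n. \<Sum>x\<in>UNIV. path_law p \<pi> (x # l) *
        (\<Sum>z\<in>UNIV. p ((x # l) ! n) z * (f (count_list (z # l)) - f (count_list (x # l)))\<^sup>2))"
proof -
  let ?N = "Suc n"
  let ?mv = "\<lambda>u z x. count_list u x - unit_count (u ! 0) x + unit_count z x"
  have mv_Cons: "?mv (x # l) z = count_list (z # l)" for x z :: 'a and l
    by (auto simp: unit_count_def)
  have mv_in: "?mv u z \<in> count_space ?N" if "length u = ?N" for u :: "'a list" and z
  proof -
    obtain x l where u: "u = x # l" using \<open>length u = ?N\<close> by (cases u) auto
    then have "length (z # l) = ?N" using that by simp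
    then show ?thesis unfolding u mv_Cons by (rule count_list_in_count_space)
  qed
  have law_kernel: "count_law p \<pi> ?N \<eta> * count_kernel p \<pi> ?N \<eta> \<xi>
      = (\<Sum>u\<in>count_fibre ?N \<eta>. path_law p \<pi> u *
          (\<Sum>z\<in>UNIV. p (u ! n) z * (if ?mv u z = \<xi> then 1 else 0)))" for \<eta> \<xi>
  \<comment> \<open>On an empty fibre \<open>count_law\<close> is 0 and cannot be cancelled, but
    both sides are then 0.\<close>
  proof (cases "count_fibre ?N \<eta> = {}")
    case True
    then show ?thesis by (simp add: count_kernel_def)
  next
    case False
    then have "0 < count_law p \<pi> ?N \<eta>"
      unfolding count_law_def
      by (intro sum_pos finite_subset[OF count_fibre_subset finite_length_eq] pos)
        (auto simp: count_fibre_def)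
    then have "count_law p \<pi> ?N \<eta> * count_kernel p \<pi> ?N \<eta> \<xi>
      = (\<Sum>u\<in>count_fibre ?N \<eta>. path_law p \<pi> u *
          (\<Sum>z\<in>UNIV. p (u ! n) z *
            (if (\<lambda>x. \<eta> x - unit_count (u ! 0) x + unit_count z x) = \<xi> then 1 else 0)))"
      unfolding count_kernel_def by simp
    also have "\<dots> = (\<Sum>u\<in>count_fibre ?N \<eta>. path_law p \<pi> u *
          (\<Sum>z\<in>UNIV. p (u ! n) z * (if ?mv u z = \<xi> then 1 else 0)))"
      by (intro sum.cong refl) (auto simp: count_fibre_def)
    finally show ?thesis .
  qed
  have "2 * dirichlet_form (count_space ?N) (count_kernel p \<pi> ?N) (count_law p \<pi> ?N) f
      = (\<Sum>\<eta>\<in>count_space ?N. \<Sum>\<xi>\<in>count_space ?N.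
          (\<Sum>u\<in>count_fibre ?N \<eta>. path_law p \<pi> u *
          (\<Sum>z\<in>UNIV. p (u ! n) z * (if ?mv u z = \<xi> then 1 else 0))) * (f \<xi> - f \<eta>)\<^sup>2)"
    unfolding dirichlet_form_def law_kernel by simp
  also have "\<dots> = (\<Sum>\<eta>\<in>count_space ?N. \<Sum>u\<in>count_fibre ?N \<eta>. path_law p \<pi> u *
          (\<Sum>z\<in>UNIV. p (u ! n) z * (f (?mv u z) - f (count_list u))\<^sup>2))"
  proof (intro sum.cong refl)
    fix \<eta> :: "'a \<Rightarrow> nat"
    have "(\<Sum>\<xi>\<in>count_space ?N. (\<Sum>u\<in>count_fibre ?N \<eta>. path_law p \<pi> u *
          (\<Sum>z\<in>UNIV. p (u ! n) z * (if ?mv u z = \<xi> then 1 else 0))) * (f \<xi> - f \<eta>)\<^sup>2)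
        = (\<Sum>u\<in>count_fibre ?N \<eta>. path_law p \<pi> u * (\<Sum>z\<in>UNIV. p (u ! n) z *
          (\<Sum>\<xi>\<in>count_space ?N. if ?mv u z = \<xi> then (f \<xi> - f \<eta>)\<^sup>2 else 0)))"
      unfolding sum_distrib_left sum_distrib_right
      by (subst sum.swap, rule sum.cong[OF refl], subst sum.swap)
        (auto intro!: sum.cong)
    also have "\<dots> = (\<Sum>u\<in>count_fibre ?N \<eta>. path_law p \<pi> u *
          (\<Sum>z\<in>UNIV. p (u ! n) z * (f (?mv u z) - f (count_list u))\<^sup>2))"
    proof (intro sum.cong refl arg_cong2[where f = "(*)"])
      fix u z assume "u \<in> count_fibre ?N \<eta>"
      then have u: "length u = ?N" "count_list u = \<eta>" by (auto simp: count_fibre_def)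
      \<comment> \<open>The move stays in the count space, so exactly one \<open>\<xi>\<close>
        matches the indicator.\<close>
      show "(\<Sum>\<xi>\<in>count_space ?N. if ?mv u z = \<xi> then (f \<xi> - f \<eta>)\<^sup>2 else 0)
          = (f (?mv u z) - f (count_list u))\<^sup>2"
        using mv_in[OF u(1), of z] by (subst sum.delta'[OF finite_count_space]) (simp add: u(2))
    qed
    finally show "(\<Sum>\<xi>\<in>count_space ?N. (\<Sum>u\<in>count_fibre ?N \<eta>. path_law p \<pi> u *
          (\<Sum>z\<in>UNIV. p (u ! n) z * (if ?mv u z = \<xi> then 1 else 0))) * (f \<xi> - f \<eta>)\<^sup>2)
        = (\<Sum>u\<in>count_fibre ?N \<eta>. path_law p \<pi> u *
          (\<Sum>z\<in>UNIV. p (u ! n) z * (f (?mv u z) - f (count_list u))\<^sup>2))" .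
  qed
  also have "\<dots> = (\<Sum>u | length u = ?N. path_law p \<pi> u *
          (\<Sum>z\<in>UNIV. p (u ! n) z * (f (?mv u z) - f (count_list u))\<^sup>2))"
    by (rule sum_count_fibre)
  finally show ?thesis
    unfolding sum_length_Suc mv_Cons .
qed

text \<open>One factor \<open>c\<close> pays for the transition into \<open>x\<close>, the other for
  drawing \<open>z\<close> from the last state; \<open>site_energy\<close> weights neither.\<close>

lemma (in uniformly_positive_chain) site_energy_le_dirichlet_form:
  assumes rev: "\<And>x y. \<pi> x * p x y = \<pi> y * p y x"
  shows "c\<^sup>2 * site_energy (\<lambda>l. f (count_list l)) n
    \<le> 2 * dirichlet_form (count_space (Suc n)) (count_kernel p \<pi> (Suc n)) (count_law p \<pi> (Suc n)) f"
proof -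
  have law: "path_law p \<pi> u = law u" if "length u = Suc n" for u
    using that by (intro path_law_eq_law rev) auto
  let ?d = "\<lambda>l x z. (f (count_list (z # l)) - f (count_list (x # l)))\<^sup>2"
  have "c\<^sup>2 * site_energy (\<lambda>l. f (count_list l)) n
      = (\<Sum>l | length l = n. \<Sum>x\<in>UNIV. law l * c * (\<Sum>z\<in>UNIV. c * ?d l x z))"
    unfolding site_energy_def sum_distrib_left
    by (intro sum.cong refl) (simp add: power2_eq_square[of c] power2_commute mult_ac)
  also have "\<dots> \<le> (\<Sum>l | length l = n. \<Sum>x\<in>UNIV. law (x # l) *
      (\<Sum>z\<in>UNIV. p ((x # l) ! n) z * ?d l x z))"
  proof (intro sum_mono mult_mono)
    fix l x z
    show "law l * c \<le> law (x # l)"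
      using step_ge law_pos by (simp add: less_imp_le)
    show "0 \<le> law (x # l)"
      by (rule less_imp_le[OF law_pos])
    show "0 \<le> (\<Sum>z\<in>UNIV. c * ?d l x z)"
      using c_pos by (intro sum_nonneg) simp
  qed (simp_all add: p_ge less_imp_le[OF p_pos])
  also have "\<dots> = 2 * dirichlet_form (count_space (Suc n)) (count_kernel p \<pi> (Suc n))
      (count_law p \<pi> (Suc n)) f"
    by (subst dirichlet_form_count_kernel) (simp_all add: law law_pos)
  finally show ?thesis .
qed

text \<open>This makes the set under the infimum in \<open>spectral_gap\<close> nonempty. The
  witness counts visits to \<open>a\<close>: it is \<open>n\<close> on the constant path at
  \<open>a\<close> and 0 on the one at \<open>b\<close>, and both paths have positive
  probability.\<close>

lemma (in uniformly_positive_chain) var_on_pos_exists: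
  assumes "CARD('a) \<ge> 2" "n \<ge> 1" and rev: "\<And>x y. \<pi> x * p x y = \<pi> y * p y x"
  shows "\<exists>f. var_on (count_space n) (count_law p \<pi> n) f > 0"
proof -
  obtain a b :: 'a where ab: "a \<noteq> b"
    using assms(1) card_le_Suc0_iff_eq[of "UNIV :: 'a set"] by force
  define f :: "('a \<Rightarrow> nat) \<Rightarrow> real" where "f \<eta> = real (\<eta> a)" for \<eta>
  define M where "M = (\<Sum>u | length u = n. path_law p \<pi> u * f (count_list u))"
  have pos: "0 < path_law p \<pi> u" if "length u = n" for u
    using that assms path_law_eq_law[OF rev, of u] law_pos by fastforce
  have var: "var_on (count_space n) (count_law p \<pi> n) f
      = (\<Sum>u | length u = n. path_law p \<pi> u * (f (count_list u) - M)\<^sup>2)"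
    unfolding var_on_def sum_count_law M_def ..
  have "var_on (count_space n) (count_law p \<pi> n) f \<noteq> 0"
  proof
    assume "var_on (count_space n) (count_law p \<pi> n) f = 0"
    then have 0: "\<forall>u\<in>{u. length u = n}. path_law p \<pi> u * (f (count_list u) - M)\<^sup>2 = 0"
      unfolding var using pos
      by (subst (asm) sum_nonneg_eq_0_iff) (auto intro!: finite_length_eq mult_nonneg_nonneg less_imp_le[OF pos])
    have "f (count_list u) = M" if "length u = n" for u
      using bspec[OF 0, of u] pos[of u] that by simp
    from this[of "replicate n a"] this[of "replicate n b"]
    have "f (count_list (replicate n a)) = f (count_list (replicate n b))" by simp
    moreover have "count_list (replicate k x) a = (if x = a then k else 0)" for k x
      by (induction k) auto
    ultimately show False using ab assms(2) by (simp add: f_def)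
  qed
  moreover have "var_on (count_space n) (count_law p \<pi> n) f \<ge> 0"
    unfolding var using pos by (intro sum_nonneg mult_nonneg_nonneg) (auto intro: less_imp_le)
  ultimately show ?thesis by (intro exI[of _ f]) linarith
qed

section \<open>Dobrushin coefficient and minimal entry\<close>

lemma total_variation_le_dobrushin: "(1/2) * (\<Sum>z\<in>UNIV. \<bar>p x z - p y z\<bar>) \<le> dobrushin p"
proof -
  have "{(1/2) * (\<Sum>z\<in>UNIV. \<bar>p x z - p y z\<bar>) | x y. True}
      = (\<lambda>(x, y). (1/2) * (\<Sum>z\<in>UNIV. \<bar>p x z - p y z\<bar>)) ` UNIV"
    by (auto simp: image_def)
  then show ?thesis unfolding dobrushin_def by (intro Max_ge) auto
qed

text \<open>For positive entries the difference is strictly smaller in absolute value than the sum,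
  and the sums add up to 2.\<close>

lemma (in uniformly_positive_chain) dobrushin_less_1: "dobrushin p < 1"
proof -
  have S: "{(1/2) * (\<Sum>z\<in>UNIV. \<bar>p x z - p y z\<bar>) | x y. True}
      = (\<lambda>(x, y). (1/2) * (\<Sum>z\<in>UNIV. \<bar>p x z - p y z\<bar>)) ` UNIV"
    by (auto simp: image_def)
  have "(1/2) * (\<Sum>z\<in>UNIV. \<bar>p x z - p y z\<bar>) < 1" for x y
  proof -
    have "(\<Sum>z\<in>UNIV. \<bar>p x z - p y z\<bar>) < (\<Sum>z\<in>UNIV. p x z + p y z)"
      using p_pos by (intro sum_strict_mono) (auto simp: abs_less_iff add_strict_increasing)
    then show ?thesis by (simp add: sum.distrib p_sum)
  qed
  then show ?thesis unfolding dobrushin_def S by (subst Max_less_iff) auto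
qed

lemma min_entry_le: "min_entry p \<le> p x y"
proof -
  have "{p x y | x y. True} = (\<lambda>(x, y). p x y) ` UNIV"
    by (auto simp: image_def)
  then show ?thesis unfolding min_entry_def by (intro Min_le) auto
qed

section \<open>The bound on the spectral gap\<close>

theorem theorem1p1:
  fixes p :: "'a::finite \<Rightarrow> 'a \<Rightarrow> real" and \<pi> :: "'a \<Rightarrow> real" and n :: nat
  assumes "CARD('a) \<ge> 2"
    and "markov_kernel_on UNIV p"
    and "stationary_on UNIV p \<pi>"
    and "reversible_on UNIV p \<pi>"
    and "min_entry p > 0"
    and "n \<ge> 2"
  shows "spectral_gap (count_space n) (count_kernel p \<pi> n) (count_law p \<pi> n)
           \<ge> min_entry p ^ 4 * (1 - sqrt (dobrushin p))\<^sup>2 / 4 * (1 / real n)"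
proof -
  define c where "c = min_entry p"
  define s where "s = sqrt (dobrushin p)"
  have c_pos: "0 < c" using assms(5) by (simp add: c_def)
  have p_ge: "c \<le> p x y" for x y by (simp add: c_def min_entry_le)
  have pi: "0 \<le> \<pi> x" "(\<Sum>x\<in>UNIV. \<pi> x) = 1" for x
    using assms(3) by (auto simp: stationary_on_def distribution_on_def)
  interpret uniformly_positive_chain p \<pi> c
  proof
    show "(\<Sum>y\<in>UNIV. p x y) = 1" for x
      using assms(2) by (simp add: markov_kernel_on_def distribution_on_def)
    show "c \<le> \<pi> y" for y
    proof -
      \<comment> \<open>By stationarity \<open>\<pi> y\<close> is an average of the entries
        \<open>p x y\<close>, each at least \<open>c\<close>.\<close>
      have "c = (\<Sum>x\<in>UNIV. \<pi> x * c)"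
        using pi(2) by (simp flip: sum_distrib_right)
      also have "\<dots> \<le> (\<Sum>x\<in>UNIV. \<pi> x * p x y)"
        by (intro sum_mono mult_left_mono p_ge pi)
      also have "\<dots> = \<pi> y" using assms(3) by (simp add: stationary_on_def)
      finally show ?thesis .
    qed
  qed (fact c_pos p_ge pi)+
  have rev: "\<pi> x * p x y = \<pi> y * p y x" for x y
    using assms(4) by (simp add: reversible_on_def)
  obtain k where n: "n = Suc k" using assms(6) by (cases n) auto
  have law: "path_law p \<pi> u = law u" if "length u = n" for u
    using that n by (intro path_law_eq_law rev) auto
  have s1: "s < 1" using dobrushin_less_1 by (simp add: s_def)
  have "c ^ 4 * (1 - s)\<^sup>2 / 4 * (1 / real n)
      \<le> dirichlet_form (count_space n) (count_kernel p \<pi> n) (count_law p \<pi> n) f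
        / var_on (count_space n) (count_law p \<pi> n) f" (is "?g \<le> ?E / _")
    if V: "var_on (count_space n) (count_law p \<pi> n) f > 0" (is "?V > 0") for f
  proof -
    let ?S = "site_energy (\<lambda>l. f (count_list l)) k"
    have "?V = (\<Sum>l | length l = Suc k. law l * (f (count_list l))\<^sup>2)
        - (\<Sum>l | length l = Suc k. law l * f (count_list l))\<^sup>2"
      using sum_law[of n] by (subst var_on_count_law) (simp_all add: law n[symmetric])
    also have "\<dots> \<le> real n * (?S / c / (1 - s)\<^sup>2 / 2)"
      unfolding s_def n
      by (rule variance_le_site_energy)
        (simp_all only: total_variation_le_dobrushin dobrushin_less_1)
    also have "\<dots> \<le> real n * ((2 * ?E / c\<^sup>2) / c / (1 - s)\<^sup>2 / 2)"
      using site_energy_le_dirichlet_form[OF rev, of f k] c_pos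
      by (intro mult_left_mono divide_right_mono) (simp_all add: n field_simps)
    finally have "?V \<le> real n * ?E / (c ^ 3 * (1 - s)\<^sup>2)"
      by (simp add: power2_eq_square power3_eq_cube)
    then have VE: "c ^ 3 * (1 - s)\<^sup>2 / real n * ?V \<le> ?E"
      using c_pos s1 n by (simp add: field_simps)
    \<comment> \<open>The estimate obtained has \<open>c ^ 3\<close>; the stated constant is weaker
      because \<open>c \<le> 1\<close>.\<close>
    have "c ^ 4 / 4 \<le> c ^ 3"
      using c_pos c_le_1 by (simp add: power_Suc numeral_eq_Suc)
    then have "c ^ 4 / 4 * ((1 - s)\<^sup>2 / real n) \<le> c ^ 3 * ((1 - s)\<^sup>2 / real n)"
      by (intro mult_right_mono) auto
    then have "?g * ?V \<le> c ^ 3 * (1 - s)\<^sup>2 / real n * ?V"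
      using V by (intro mult_right_mono) auto
    then show ?thesis using V VE by (simp add: pos_le_divide_eq)
  qed
  moreover have "\<exists>f. var_on (count_space n) (count_law p \<pi> n) f > 0"
    using assms(1,6) by (intro var_on_pos_exists rev) auto
  ultimately show ?thesis
    unfolding spectral_gap_def c_def s_def by (intro cInf_greatest) auto
qed

end
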